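(* Let $\mathcal{E}$ be a complete and cocomplete, closed symmetric monoidal exact category. Suppose that $\mathcal{E}$ has a left pseudo-compatible model structure with Waldhausen pair $(\mathfrak{C},\mathfrak{W})$ such that: (a) every cofibration is pure; (b) if $X,Y\in\mathfrak{C}$ then $X\otimes Y\in\mathfrak{C}$; (c) if $X,Y\in\mathfrak{C}$ and one of them is in $\mathfrak{W}$, then $X\otimes Y\in\mathfrak{C}\cap\mathfrak{W}$; (d) if $C\to k$ is an acyclic fibration with $C\in\mathfrak{C}$ ($k$ the monoidal unit), then for any object $X$ of $\mathcal{E}$ the map $C\otimes X\to X$ is a weak equivalence. In addition, suppose that: (1) if $X\in\mathfrak{C}\cap\mathfrak{W}$ and $Y$ is arbitrary, then $X\otimes Y\in\mathfrak{W}$; (2) transfinite compositions of weak equivalences which are also pure monics with cokernel of the form $X\otimes Y$ with $X\in\mathfrak{C}\cap\mathfrak{W}$ and $Y\in\mathcal{E}$ are still weak equivalences. Then the model structure satisfies the monoid axiom.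
   Context: Exact categories are in the sense of Quillen, weakly idempotent complete. A short exact sequence in a monoidal exact category is pure if it remains exact after tensoring with any object; a pure monic is an admissible monic which is the first map of a pure short exact sequence. A model structure on an exact category is left pseudo-compatible with Waldhausen pair $(\mathfrak{C},\mathfrak{W})$ (classes of objects) if: $\mathfrak{W}$ is thick (if two terms of a short exact sequence lie in $\mathfrak{W}$ so does the third); a map is a cofibration (resp. acyclic cofibration) iff it is an admissible monic with cokernel in $\mathfrak{C}$ (resp. $\mathfrak{C}\cap\mathfrak{W}$); and an admissible monic is a weak equivalence iff its cokernel is in $\mathfrak{W}$. Monoid axiom: every morphism obtained as a transfinite composition of pushouts of tensor products of acyclic cofibrations with arbitrary objects is a weak equivalence. *)

theory Defs
  imports "HOL-Algebra.Group"
begin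

unbundle cardinal_syntax


section \<open>Categories, functors, limits and colimits\<close>

record ('o, 'm) cat =
  Obj :: "'o set"
  Arr :: "'m set"
  Dom :: "'m \<Rightarrow> 'o"
  Cod :: "'m \<Rightarrow> 'o"
  Id :: "'o \<Rightarrow> 'm"
  Comp :: "'m \<Rightarrow> 'm \<Rightarrow> 'm" (infixl \<open>\<cdot>\<index>\<close> 70)

definition Hom :: "('o, 'm, 'x) cat_scheme \<Rightarrow> 'o \<Rightarrow> 'o \<Rightarrow> 'm set" where
  "Hom C X Y = {f \<in> Arr C. Dom C f = X \<and> Cod C f = Y}"

locale category =
  fixes C :: "('o, 'm, 'x) cat_scheme" (structure)
  assumes Dom_in: "f \<in> Arr C \<Longrightarrow> Dom C f \<in> Obj C"
    and Cod_in: "f \<in> Arr C \<Longrightarrow> Cod C f \<in> Obj C"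
    and Id_in: "X \<in> Obj C \<Longrightarrow> Id C X \<in> Hom C X X"
    and Comp_in: "\<lbrakk>f \<in> Hom C X Y; g \<in> Hom C Y Z\<rbrakk> \<Longrightarrow> g \<cdot> f \<in> Hom C X Z"
    and Comp_assoc: "\<lbrakk>f \<in> Hom C W X; g \<in> Hom C X Y; h \<in> Hom C Y Z\<rbrakk>
      \<Longrightarrow> (h \<cdot> g) \<cdot> f = h \<cdot> (g \<cdot> f)"
    and Id_left: "f \<in> Hom C X Y \<Longrightarrow> Id C Y \<cdot> f = f"
    and Id_right: "f \<in> Hom C X Y \<Longrightarrow> f \<cdot> Id C X = f"

definition iso_arr :: "('o, 'm, 'x) cat_scheme \<Rightarrow> 'm \<Rightarrow> bool" where
  "iso_arr C f \<longleftrightarrow> f \<in> Arr C \<and>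
     (\<exists>g \<in> Hom C (Cod C f) (Dom C f).
        g \<cdot>\<^bsub>C\<^esub> f = Id C (Dom C f) \<and> f \<cdot>\<^bsub>C\<^esub> g = Id C (Cod C f))"

definition is_functor ::
  "('i, 'a, 'y) cat_scheme \<Rightarrow> ('o, 'm, 'x) cat_scheme \<Rightarrow> ('i \<Rightarrow> 'o) \<Rightarrow> ('a \<Rightarrow> 'm) \<Rightarrow> bool" where
  "is_functor J C F\<^sub>o F\<^sub>a \<longleftrightarrow>
     (\<forall>i \<in> Obj J. F\<^sub>o i \<in> Obj C \<and> F\<^sub>a (Id J i) = Id C (F\<^sub>o i)) \<and>
     (\<forall>u \<in> Arr J. F\<^sub>a u \<in> Hom C (F\<^sub>o (Dom J u)) (F\<^sub>o (Cod J u))) \<and>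
     (\<forall>u \<in> Arr J. \<forall>v \<in> Arr J. Cod J u = Dom J v \<longrightarrow> F\<^sub>a (v \<cdot>\<^bsub>J\<^esub> u) = F\<^sub>a v \<cdot>\<^bsub>C\<^esub> F\<^sub>a u)"

definition is_cocone ::
  "('i, 'a, 'y) cat_scheme \<Rightarrow> ('o, 'm, 'x) cat_scheme \<Rightarrow> ('i \<Rightarrow> 'o) \<Rightarrow> ('a \<Rightarrow> 'm)
    \<Rightarrow> 'o \<Rightarrow> ('i \<Rightarrow> 'm) \<Rightarrow> bool" where
  "is_cocone J C F\<^sub>o F\<^sub>a L \<iota> \<longleftrightarrow>
     L \<in> Obj C \<and> (\<forall>i \<in> Obj J. \<iota> i \<in> Hom C (F\<^sub>o i) L) \<and>
     (\<forall>u \<in> Arr J. \<iota> (Cod J u) \<cdot>\<^bsub>C\<^esub> F\<^sub>a u = \<iota> (Dom J u))"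

definition is_colimit ::
  "('i, 'a, 'y) cat_scheme \<Rightarrow> ('o, 'm, 'x) cat_scheme \<Rightarrow> ('i \<Rightarrow> 'o) \<Rightarrow> ('a \<Rightarrow> 'm)
    \<Rightarrow> 'o \<Rightarrow> ('i \<Rightarrow> 'm) \<Rightarrow> bool" where
  "is_colimit J C F\<^sub>o F\<^sub>a L \<iota> \<longleftrightarrow>
     is_cocone J C F\<^sub>o F\<^sub>a L \<iota> \<and>
     (\<forall>M \<mu>. is_cocone J C F\<^sub>o F\<^sub>a M \<mu> \<longrightarrow>
        (\<exists>!h. h \<in> Hom C L M \<and> (\<forall>i \<in> Obj J. h \<cdot>\<^bsub>C\<^esub> \<iota> i = \<mu> i)))"

definition is_cone ::
  "('i, 'a, 'y) cat_scheme \<Rightarrow> ('o, 'm, 'x) cat_scheme \<Rightarrow> ('i \<Rightarrow> 'o) \<Rightarrow> ('a \<Rightarrow> 'm)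
    \<Rightarrow> 'o \<Rightarrow> ('i \<Rightarrow> 'm) \<Rightarrow> bool" where
  "is_cone J C F\<^sub>o F\<^sub>a L \<pi> \<longleftrightarrow>
     L \<in> Obj C \<and> (\<forall>i \<in> Obj J. \<pi> i \<in> Hom C L (F\<^sub>o i)) \<and>
     (\<forall>u \<in> Arr J. F\<^sub>a u \<cdot>\<^bsub>C\<^esub> \<pi> (Dom J u) = \<pi> (Cod J u))"

definition is_limit ::
  "('i, 'a, 'y) cat_scheme \<Rightarrow> ('o, 'm, 'x) cat_scheme \<Rightarrow> ('i \<Rightarrow> 'o) \<Rightarrow> ('a \<Rightarrow> 'm)
    \<Rightarrow> 'o \<Rightarrow> ('i \<Rightarrow> 'm) \<Rightarrow> bool" where
  "is_limit J C F\<^sub>o F\<^sub>a L \<pi> \<longleftrightarrow>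
     is_cone J C F\<^sub>o F\<^sub>a L \<pi> \<and>
     (\<forall>M \<mu>. is_cone J C F\<^sub>o F\<^sub>a M \<mu> \<longrightarrow>
        (\<exists>!h. h \<in> Hom C M L \<and> (\<forall>i \<in> Obj J. \<pi> i \<cdot>\<^bsub>C\<^esub> h = \<mu> i)))"

text \<open>
  Smallness is measured by a cardinal \<open>\<kappa>\<close>: a set is small if its cardinality is below \<open>\<kappa>\<close>.
  For inaccessible \<open>\<kappa>\<close> this is smallness with respect to a Grothendieck universe; HOL does not
  prove that inaccessible cardinals exist, and only regularity and uncountability are imposed.
  Every small category is isomorphic to one whose objects and arrows are taken from the
  underlying type of \<open>\<kappa>\<close>, and likewise for small well-orders, so indexing by that type
  loses no generality.
\<close>

definition smallness_bound :: "'u rel \<Rightarrow> bool" where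
  "smallness_bound \<kappa> \<longleftrightarrow> Card_order \<kappa> \<and> natLeq <o \<kappa> \<and> regularCard \<kappa>"

definition small_category :: "'u rel \<Rightarrow> ('u, 'u) cat \<Rightarrow> bool" where
  "small_category \<kappa> J \<longleftrightarrow> category J \<and> |Obj J| <o \<kappa> \<and> |Arr J| <o \<kappa>"

definition cocomplete :: "'u rel \<Rightarrow> ('o, 'm, 'x) cat_scheme \<Rightarrow> bool" where
  "cocomplete \<kappa> C \<longleftrightarrow>
     (\<forall>(J :: ('u, 'u) cat) F\<^sub>o F\<^sub>a. small_category \<kappa> J \<and> is_functor J C F\<^sub>o F\<^sub>a \<longrightarrow>
        (\<exists>L \<iota>. is_colimit J C F\<^sub>o F\<^sub>a L \<iota>))"

definition complete :: "'u rel \<Rightarrow> ('o, 'm, 'x) cat_scheme \<Rightarrow> bool" where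
  "complete \<kappa> C \<longleftrightarrow>
     (\<forall>(J :: ('u, 'u) cat) F\<^sub>o F\<^sub>a. small_category \<kappa> J \<and> is_functor J C F\<^sub>o F\<^sub>a \<longrightarrow>
        (\<exists>L \<pi>. is_limit J C F\<^sub>o F\<^sub>a L \<pi>))"

text \<open>
  \<open>is_pushout C f g f' g'\<close>: the arrow \<open>f'\<close> is the pushout of \<open>f : A \<rightarrow> B\<close> along
  \<open>g : A \<rightarrow> A'\<close>, with \<open>g' : B \<rightarrow> B'\<close> and \<open>f' : A' \<rightarrow> B'\<close>.
\<close>

definition is_pushout :: "('o, 'm, 'x) cat_scheme \<Rightarrow> 'm \<Rightarrow> 'm \<Rightarrow> 'm \<Rightarrow> 'm \<Rightarrow> bool" where
  "is_pushout C f g f' g' \<longleftrightarrow>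
     f \<in> Arr C \<and> g \<in> Arr C \<and> f' \<in> Arr C \<and> g' \<in> Arr C \<and>
     Dom C f = Dom C g \<and> Dom C g' = Cod C f \<and> Dom C f' = Cod C g \<and> Cod C f' = Cod C g' \<and>
     f' \<cdot>\<^bsub>C\<^esub> g = g' \<cdot>\<^bsub>C\<^esub> f \<and>
     (\<forall>T. \<forall>u \<in> Hom C (Cod C g) T. \<forall>v \<in> Hom C (Cod C f) T.
        u \<cdot>\<^bsub>C\<^esub> g = v \<cdot>\<^bsub>C\<^esub> f \<longrightarrow>
        (\<exists>!h. h \<in> Hom C (Cod C f') T \<and> h \<cdot>\<^bsub>C\<^esub> f' = u \<and> h \<cdot>\<^bsub>C\<^esub> g' = v))"

text \<open>
  \<open>is_pullback C f g f' g'\<close>: the arrow \<open>f'\<close> is the pullback of \<open>f : A \<rightarrow> B\<close> along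
  \<open>g : B' \<rightarrow> B\<close>, with \<open>g' : A' \<rightarrow> A\<close> and \<open>f' : A' \<rightarrow> B'\<close>.
\<close>

definition is_pullback :: "('o, 'm, 'x) cat_scheme \<Rightarrow> 'm \<Rightarrow> 'm \<Rightarrow> 'm \<Rightarrow> 'm \<Rightarrow> bool" where
  "is_pullback C f g f' g' \<longleftrightarrow>
     f \<in> Arr C \<and> g \<in> Arr C \<and> f' \<in> Arr C \<and> g' \<in> Arr C \<and>
     Cod C f = Cod C g \<and> Cod C g' = Dom C f \<and> Cod C f' = Dom C g \<and> Dom C f' = Dom C g' \<and>
     g \<cdot>\<^bsub>C\<^esub> f' = f \<cdot>\<^bsub>C\<^esub> g' \<and>
     (\<forall>T. \<forall>u \<in> Hom C T (Dom C g). \<forall>v \<in> Hom C T (Dom C f).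
        g \<cdot>\<^bsub>C\<^esub> u = f \<cdot>\<^bsub>C\<^esub> v \<longrightarrow>
        (\<exists>!h. h \<in> Hom C T (Dom C f') \<and> f' \<cdot>\<^bsub>C\<^esub> h = u \<and> g' \<cdot>\<^bsub>C\<^esub> h = v))"


section \<open>Transfinite compositions\<close>

text \<open>The full subcategory on \<open>A\<close> of the preorder category given by \<open>r\<close>.\<close>

definition order_cat :: "'u rel \<Rightarrow> 'u set \<Rightarrow> ('u, 'u \<times> 'u) cat" where
  "order_cat r A =
     \<lparr>Obj = A, Arr = r \<inter> A \<times> A, Dom = fst, Cod = snd,
      Id = (\<lambda>a. (a, a)), Comp = (\<lambda>v u. (fst u, snd v))\<rparr>"

definition immediate_succ :: "'u rel \<Rightarrow> 'u \<Rightarrow> 'u \<Rightarrow> bool" where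
  "immediate_succ r a b \<longleftrightarrow> a \<in> underS r b \<and> (\<forall>c \<in> underS r b. (c, a) \<in> r)"

definition limit_point :: "'u rel \<Rightarrow> 'u \<Rightarrow> bool" where
  "limit_point r b \<longleftrightarrow> b \<in> Field r \<and> underS r b \<noteq> {} \<and> \<not> (\<exists>a. immediate_succ r a b)"

text \<open>
  The ordinal \<open>\<lambda>\<close> is represented by a well-order \<open>r\<close>, and a \<open>\<lambda>\<close>-sequence is a
  functor on \<open>r\<close> that is continuous at limit stages.
\<close>

definition transfinite_sequence ::
  "('o, 'm, 'x) cat_scheme \<Rightarrow> 'u rel \<Rightarrow> ('u \<Rightarrow> 'o) \<Rightarrow> ('u \<times> 'u \<Rightarrow> 'm) \<Rightarrow> bool" where
  "transfinite_sequence C r F\<^sub>o F\<^sub>a \<longleftrightarrow>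
     is_functor (order_cat r (Field r)) C F\<^sub>o F\<^sub>a \<and>
     (\<forall>b. limit_point r b \<longrightarrow>
        is_colimit (order_cat r (underS r b)) C F\<^sub>o F\<^sub>a (F\<^sub>o b) (\<lambda>a. F\<^sub>a (a, b)))"

definition transfinite_composition ::
  "'u rel \<Rightarrow> ('o, 'm, 'x) cat_scheme \<Rightarrow> 'm set \<Rightarrow> 'm \<Rightarrow> bool" where
  "transfinite_composition \<kappa> C I f \<longleftrightarrow>
     (\<exists>(r :: 'u rel) F\<^sub>o F\<^sub>a L \<iota> z.
        Well_order r \<and> |Field r| <o \<kappa> \<and> z \<in> Field r \<and> underS r z = {} \<and>
        transfinite_sequence C r F\<^sub>o F\<^sub>a \<and>
        (\<forall>a b. immediate_succ r a b \<longrightarrow> F\<^sub>a (a, b) \<in> I) \<and>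
        is_colimit (order_cat r (Field r)) C F\<^sub>o F\<^sub>a L \<iota> \<and>
        f = \<iota> z)"


section \<open>Exact categories\<close>

text \<open>
  \<open>Conf\<close> is the class of short exact sequences, each given by its pair of arrows
  \<open>(i, p)\<close> with \<open>i : A \<rightarrow> B\<close> and \<open>p : B \<rightarrow> D\<close>.
\<close>

record ('o, 'm) exact_cat = "('o, 'm) cat" +
  Plus :: "'m \<Rightarrow> 'm \<Rightarrow> 'm" (infixl \<open>\<^bold>+\<index>\<close> 65)
  Zero :: "'o \<Rightarrow> 'o \<Rightarrow> 'm"
  Conf :: "('m \<times> 'm) set"

definition is_kernel :: "('o, 'm, 'x) exact_cat_scheme \<Rightarrow> 'm \<Rightarrow> 'm \<Rightarrow> bool" where
  "is_kernel C i p \<longleftrightarrow>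
     i \<in> Arr C \<and> p \<in> Arr C \<and> Cod C i = Dom C p \<and> p \<cdot>\<^bsub>C\<^esub> i = Zero C (Dom C i) (Cod C p) \<and>
     (\<forall>T. \<forall>t \<in> Hom C T (Dom C p). p \<cdot>\<^bsub>C\<^esub> t = Zero C T (Cod C p) \<longrightarrow>
        (\<exists>!s. s \<in> Hom C T (Dom C i) \<and> i \<cdot>\<^bsub>C\<^esub> s = t))"

definition is_cokernel :: "('o, 'm, 'x) exact_cat_scheme \<Rightarrow> 'm \<Rightarrow> 'm \<Rightarrow> bool" where
  "is_cokernel C i p \<longleftrightarrow>
     i \<in> Arr C \<and> p \<in> Arr C \<and> Cod C i = Dom C p \<and> p \<cdot>\<^bsub>C\<^esub> i = Zero C (Dom C i) (Cod C p) \<and>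
     (\<forall>T. \<forall>t \<in> Hom C (Cod C i) T. t \<cdot>\<^bsub>C\<^esub> i = Zero C (Dom C i) T \<longrightarrow>
        (\<exists>!s. s \<in> Hom C (Cod C p) T \<and> s \<cdot>\<^bsub>C\<^esub> p = t))"

definition admissible_monic :: "('o, 'm, 'x) exact_cat_scheme \<Rightarrow> 'm \<Rightarrow> bool" where
  "admissible_monic C i \<longleftrightarrow> (\<exists>p. (i, p) \<in> Conf C)"

definition admissible_epic :: "('o, 'm, 'x) exact_cat_scheme \<Rightarrow> 'm \<Rightarrow> bool" where
  "admissible_epic C p \<longleftrightarrow> (\<exists>i. (i, p) \<in> Conf C)"

locale additive_category = category C
  for C :: "('o, 'm, 'x) exact_cat_scheme" (structure) +
  assumes hom_group: "\<lbrakk>X \<in> Obj C; Y \<in> Obj C\<rbrakk>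
      \<Longrightarrow> comm_group \<lparr>carrier = Hom C X Y, mult = Plus C, one = Zero C X Y\<rparr>"
    and Plus_Comp: "\<lbrakk>f \<in> Hom C X Y; g \<in> Hom C Y Z; h \<in> Hom C Y Z\<rbrakk>
      \<Longrightarrow> (g \<^bold>+ h) \<cdot> f = (g \<cdot> f) \<^bold>+ (h \<cdot> f)"
    and Comp_Plus: "\<lbrakk>f \<in> Hom C X Y; g \<in> Hom C X Y; h \<in> Hom C Y Z\<rbrakk>
      \<Longrightarrow> h \<cdot> (f \<^bold>+ g) = (h \<cdot> f) \<^bold>+ (h \<cdot> g)"
    and zero_object: "\<exists>N \<in> Obj C. \<forall>X \<in> Obj C. (\<exists>!f. f \<in> Hom C X N) \<and> (\<exists>!f. f \<in> Hom C N X)"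
    and biproducts: "\<lbrakk>X \<in> Obj C; Y \<in> Obj C\<rbrakk>
      \<Longrightarrow> \<exists>B \<in> Obj C. \<exists>i\<^sub>1 \<in> Hom C X B. \<exists>i\<^sub>2 \<in> Hom C Y B. \<exists>p\<^sub>1 \<in> Hom C B X. \<exists>p\<^sub>2 \<in> Hom C B Y.
            p\<^sub>1 \<cdot> i\<^sub>1 = Id C X \<and> p\<^sub>2 \<cdot> i\<^sub>2 = Id C Y \<and>
            p\<^sub>2 \<cdot> i\<^sub>1 = Zero C X Y \<and> p\<^sub>1 \<cdot> i\<^sub>2 = Zero C Y X \<and>
            (i\<^sub>1 \<cdot> p\<^sub>1) \<^bold>+ (i\<^sub>2 \<cdot> p\<^sub>2) = Id C B"

locale exact_category = additive_category C
  for C :: "('o, 'm, 'x) exact_cat_scheme" (structure) +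
  assumes Conf_kernel_cokernel: "(i, p) \<in> Conf C \<Longrightarrow> is_kernel C i p \<and> is_cokernel C i p"
    and Conf_iso: "\<lbrakk>(i, p) \<in> Conf C; iso_arr C a; iso_arr C b; iso_arr C c;
        i' \<in> Hom C (Cod C a) (Cod C b); p' \<in> Hom C (Cod C b) (Cod C c);
        Dom C a = Dom C i; Dom C b = Cod C i; Dom C c = Cod C p;
        i' \<cdot> a = b \<cdot> i; p' \<cdot> b = c \<cdot> p\<rbrakk> \<Longrightarrow> (i', p') \<in> Conf C"
    and Id_monic: "X \<in> Obj C \<Longrightarrow> admissible_monic C (Id C X)"
    and Id_epic: "X \<in> Obj C \<Longrightarrow> admissible_epic C (Id C X)"
    and monic_Comp: "\<lbrakk>admissible_monic C f; admissible_monic C g; Cod C f = Dom C g\<rbrakk>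
      \<Longrightarrow> admissible_monic C (g \<cdot> f)"
    and epic_Comp: "\<lbrakk>admissible_epic C f; admissible_epic C g; Cod C f = Dom C g\<rbrakk>
      \<Longrightarrow> admissible_epic C (g \<cdot> f)"
    and monic_pushout: "\<lbrakk>admissible_monic C f; g \<in> Arr C; Dom C g = Dom C f\<rbrakk>
      \<Longrightarrow> \<exists>f' g'. is_pushout C f g f' g' \<and> admissible_monic C f'"
    and epic_pullback: "\<lbrakk>admissible_epic C f; g \<in> Arr C; Cod C g = Cod C f\<rbrakk>
      \<Longrightarrow> \<exists>f' g'. is_pullback C f g f' g' \<and> admissible_epic C f'"

definition weakly_idempotent_complete :: "('o, 'm, 'x) exact_cat_scheme \<Rightarrow> bool" where
  "weakly_idempotent_complete C \<longleftrightarrow>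
     (\<forall>q \<in> Arr C. (\<exists>s \<in> Hom C (Cod C q) (Dom C q). q \<cdot>\<^bsub>C\<^esub> s = Id C (Cod C q)) \<longrightarrow>
        (\<exists>i. is_kernel C i q))"


section \<open>Closed symmetric monoidal exact categories\<close>

text \<open>
  The tensor product is written \<open>\<odot>\<close> on objects and \<open>\<star>\<close> on arrows. No additivity of the
  tensor product is required: in the closed case it preserves biproducts in each variable, and
  hence is additive.
\<close>

record ('o, 'm) monoidal_exact_cat = "('o, 'm) exact_cat" +
  TensO :: "'o \<Rightarrow> 'o \<Rightarrow> 'o" (infixl \<open>\<odot>\<index>\<close> 75)
  TensA :: "'m \<Rightarrow> 'm \<Rightarrow> 'm" (infixl \<open>\<star>\<index>\<close> 75)
  Unit :: "'o"
  Assoc :: "'o \<Rightarrow> 'o \<Rightarrow> 'o \<Rightarrow> 'm"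
  LUnit :: "'o \<Rightarrow> 'm"
  RUnit :: "'o \<Rightarrow> 'm"
  Symm :: "'o \<Rightarrow> 'o \<Rightarrow> 'm"

locale closed_symmetric_monoidal = category C
  for C :: "('o, 'm, 'x) monoidal_exact_cat_scheme" (structure) +
  assumes TensO_in: "\<lbrakk>X \<in> Obj C; Y \<in> Obj C\<rbrakk> \<Longrightarrow> X \<odot> Y \<in> Obj C"
    and TensA_in: "\<lbrakk>f \<in> Hom C X X'; g \<in> Hom C Y Y'\<rbrakk> \<Longrightarrow> f \<star> g \<in> Hom C (X \<odot> Y) (X' \<odot> Y')"
    and TensA_Id: "\<lbrakk>X \<in> Obj C; Y \<in> Obj C\<rbrakk> \<Longrightarrow> Id C X \<star> Id C Y = Id C (X \<odot> Y)"
    and TensA_Comp: "\<lbrakk>f \<in> Hom C X X'; f' \<in> Hom C X' X''; g \<in> Hom C Y Y'; g' \<in> Hom C Y' Y''\<rbrakk>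
      \<Longrightarrow> (f' \<cdot> f) \<star> (g' \<cdot> g) = (f' \<star> g') \<cdot> (f \<star> g)"
    and Unit_in: "Unit C \<in> Obj C"
    and Assoc_in: "\<lbrakk>X \<in> Obj C; Y \<in> Obj C; Z \<in> Obj C\<rbrakk>
      \<Longrightarrow> Assoc C X Y Z \<in> Hom C ((X \<odot> Y) \<odot> Z) (X \<odot> (Y \<odot> Z)) \<and> iso_arr C (Assoc C X Y Z)"
    and Assoc_nat: "\<lbrakk>f \<in> Hom C X X'; g \<in> Hom C Y Y'; h \<in> Hom C Z Z'\<rbrakk>
      \<Longrightarrow> Assoc C X' Y' Z' \<cdot> ((f \<star> g) \<star> h) = (f \<star> (g \<star> h)) \<cdot> Assoc C X Y Z"
    and LUnit_in: "X \<in> Obj C \<Longrightarrow> LUnit C X \<in> Hom C (Unit C \<odot> X) X \<and> iso_arr C (LUnit C X)"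
    and LUnit_nat: "f \<in> Hom C X Y \<Longrightarrow> LUnit C Y \<cdot> (Id C (Unit C) \<star> f) = f \<cdot> LUnit C X"
    and RUnit_in: "X \<in> Obj C \<Longrightarrow> RUnit C X \<in> Hom C (X \<odot> Unit C) X \<and> iso_arr C (RUnit C X)"
    and RUnit_nat: "f \<in> Hom C X Y \<Longrightarrow> RUnit C Y \<cdot> (f \<star> Id C (Unit C)) = f \<cdot> RUnit C X"
    and Symm_in: "\<lbrakk>X \<in> Obj C; Y \<in> Obj C\<rbrakk> \<Longrightarrow> Symm C X Y \<in> Hom C (X \<odot> Y) (Y \<odot> X)"
    and Symm_nat: "\<lbrakk>f \<in> Hom C X X'; g \<in> Hom C Y Y'\<rbrakk>
      \<Longrightarrow> Symm C X' Y' \<cdot> (f \<star> g) = (g \<star> f) \<cdot> Symm C X Y"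
    and Symm_Symm: "\<lbrakk>X \<in> Obj C; Y \<in> Obj C\<rbrakk> \<Longrightarrow> Symm C Y X \<cdot> Symm C X Y = Id C (X \<odot> Y)"
    and pentagon: "\<lbrakk>W \<in> Obj C; X \<in> Obj C; Y \<in> Obj C; Z \<in> Obj C\<rbrakk>
      \<Longrightarrow> Assoc C W X (Y \<odot> Z) \<cdot> Assoc C (W \<odot> X) Y Z
        = (Id C W \<star> Assoc C X Y Z) \<cdot> (Assoc C W (X \<odot> Y) Z \<cdot> (Assoc C W X Y \<star> Id C Z))"
    and triangle: "\<lbrakk>X \<in> Obj C; Y \<in> Obj C\<rbrakk>
      \<Longrightarrow> (Id C X \<star> LUnit C Y) \<cdot> Assoc C X (Unit C) Y = RUnit C X \<star> Id C Y"
    and hexagon: "\<lbrakk>X \<in> Obj C; Y \<in> Obj C; Z \<in> Obj C\<rbrakk>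
      \<Longrightarrow> Assoc C Y Z X \<cdot> (Symm C X (Y \<odot> Z) \<cdot> Assoc C X Y Z)
        = (Id C Y \<star> Symm C X Z) \<cdot> (Assoc C Y X Z \<cdot> (Symm C X Y \<star> Id C Z))"
    and closed: "\<lbrakk>Y \<in> Obj C; Z \<in> Obj C\<rbrakk>
      \<Longrightarrow> \<exists>H \<in> Obj C. \<exists>ev \<in> Hom C (H \<odot> Y) Z.
            \<forall>X \<in> Obj C. \<forall>f \<in> Hom C (X \<odot> Y) Z. \<exists>!g. g \<in> Hom C X H \<and> ev \<cdot> (g \<star> Id C Y) = f"

locale closed_symmetric_monoidal_exact_category =
  exact_category C + closed_symmetric_monoidal C
  for C :: "('o, 'm, 'x) monoidal_exact_cat_scheme" (structure) +
  assumes weakly_idempotent_complete: "weakly_idempotent_complete C"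

definition pure_exact :: "('o, 'm, 'x) monoidal_exact_cat_scheme \<Rightarrow> 'm \<Rightarrow> 'm \<Rightarrow> bool" where
  "pure_exact C i p \<longleftrightarrow> (i, p) \<in> Conf C \<and>
     (\<forall>Z \<in> Obj C. (i \<star>\<^bsub>C\<^esub> Id C Z, p \<star>\<^bsub>C\<^esub> Id C Z) \<in> Conf C)"

definition pure_monic :: "('o, 'm, 'x) monoidal_exact_cat_scheme \<Rightarrow> 'm \<Rightarrow> bool" where
  "pure_monic C i \<longleftrightarrow> admissible_monic C i \<and> (\<exists>p. pure_exact C i p)"


section \<open>Model structures and the monoid axiom\<close>

record 'm model_str =
  Cof :: "'m set"
  Fib :: "'m set"
  Weq :: "'m set"

definition is_retract :: "('o, 'm, 'x) cat_scheme \<Rightarrow> 'm \<Rightarrow> 'm \<Rightarrow> bool" where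
  "is_retract C f g \<longleftrightarrow> f \<in> Arr C \<and> g \<in> Arr C \<and>
     (\<exists>a \<in> Hom C (Dom C f) (Dom C g). \<exists>b \<in> Hom C (Dom C g) (Dom C f).
      \<exists>a' \<in> Hom C (Cod C f) (Cod C g). \<exists>b' \<in> Hom C (Cod C g) (Cod C f).
        b \<cdot>\<^bsub>C\<^esub> a = Id C (Dom C f) \<and> b' \<cdot>\<^bsub>C\<^esub> a' = Id C (Cod C f) \<and>
        g \<cdot>\<^bsub>C\<^esub> a = a' \<cdot>\<^bsub>C\<^esub> f \<and> f \<cdot>\<^bsub>C\<^esub> b = b' \<cdot>\<^bsub>C\<^esub> g)"

definition has_lifting :: "('o, 'm, 'x) cat_scheme \<Rightarrow> 'm \<Rightarrow> 'm \<Rightarrow> bool" where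
  "has_lifting C i p \<longleftrightarrow>
     (\<forall>u \<in> Hom C (Dom C i) (Dom C p). \<forall>v \<in> Hom C (Cod C i) (Cod C p).
        p \<cdot>\<^bsub>C\<^esub> u = v \<cdot>\<^bsub>C\<^esub> i \<longrightarrow>
        (\<exists>h \<in> Hom C (Cod C i) (Dom C p). h \<cdot>\<^bsub>C\<^esub> i = u \<and> p \<cdot>\<^bsub>C\<^esub> h = v))"

locale model_structure = category C
  for C :: "('o, 'm, 'x) cat_scheme" (structure) and M :: "'m model_str" +
  assumes Cof_Arr: "Cof M \<subseteq> Arr C" and Fib_Arr: "Fib M \<subseteq> Arr C" and Weq_Arr: "Weq M \<subseteq> Arr C"
    and two_of_three: "\<lbrakk>f \<in> Arr C; g \<in> Arr C; Cod C f = Dom C g\<rbrakk> \<Longrightarrow>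
        (f \<in> Weq M \<and> g \<in> Weq M \<longrightarrow> g \<cdot> f \<in> Weq M) \<and>
        (f \<in> Weq M \<and> g \<cdot> f \<in> Weq M \<longrightarrow> g \<in> Weq M) \<and>
        (g \<in> Weq M \<and> g \<cdot> f \<in> Weq M \<longrightarrow> f \<in> Weq M)"
    and retract_Cof: "\<lbrakk>is_retract C f g; g \<in> Cof M\<rbrakk> \<Longrightarrow> f \<in> Cof M"
    and retract_Fib: "\<lbrakk>is_retract C f g; g \<in> Fib M\<rbrakk> \<Longrightarrow> f \<in> Fib M"
    and retract_Weq: "\<lbrakk>is_retract C f g; g \<in> Weq M\<rbrakk> \<Longrightarrow> f \<in> Weq M"
    and lift_Cof: "\<lbrakk>i \<in> Cof M; p \<in> Fib M \<inter> Weq M\<rbrakk> \<Longrightarrow> has_lifting C i p"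
    and lift_Fib: "\<lbrakk>i \<in> Cof M \<inter> Weq M; p \<in> Fib M\<rbrakk> \<Longrightarrow> has_lifting C i p"
    and factor_Cof: "f \<in> Arr C \<Longrightarrow>
        \<exists>i \<in> Cof M. \<exists>p \<in> Fib M \<inter> Weq M. Cod C i = Dom C p \<and> f = p \<cdot> i"
    and factor_Fib: "f \<in> Arr C \<Longrightarrow>
        \<exists>i \<in> Cof M \<inter> Weq M. \<exists>p \<in> Fib M. Cod C i = Dom C p \<and> f = p \<cdot> i"

definition thick :: "('o, 'm, 'x) exact_cat_scheme \<Rightarrow> 'o set \<Rightarrow> bool" where
  "thick C \<WW> \<longleftrightarrow> (\<forall>(i, p) \<in> Conf C.
     (Dom C i \<in> \<WW> \<and> Cod C i \<in> \<WW> \<longrightarrow> Cod C p \<in> \<WW>) \<and>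
     (Dom C i \<in> \<WW> \<and> Cod C p \<in> \<WW> \<longrightarrow> Cod C i \<in> \<WW>) \<and>
     (Cod C i \<in> \<WW> \<and> Cod C p \<in> \<WW> \<longrightarrow> Dom C i \<in> \<WW>))"

text \<open>
  Cokernels are determined up to isomorphism only; that the cokernel of \<open>i\<close> lies in a class of
  objects means that some short exact sequence starting with \<open>i\<close> ends in a member of the class.
\<close>

definition monic_with_cokernel_in :: "('o, 'm, 'x) exact_cat_scheme \<Rightarrow> 'o set \<Rightarrow> 'm \<Rightarrow> bool" where
  "monic_with_cokernel_in C \<AA> i \<longleftrightarrow> (\<exists>p. (i, p) \<in> Conf C \<and> Cod C p \<in> \<AA>)"

locale left_pseudo_compatible = model_structure C M
  for C :: "('o, 'm, 'x) exact_cat_scheme" (structure) and M :: "'m model_str" +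
  fixes \<CC> \<WW> :: "'o set"
  assumes \<CC>_Obj: "\<CC> \<subseteq> Obj C" and \<WW>_Obj: "\<WW> \<subseteq> Obj C"
    and thick: "thick C \<WW>"
    and Cof_iff: "f \<in> Cof M \<longleftrightarrow> monic_with_cokernel_in C \<CC> f"
    and acyclic_Cof_iff: "f \<in> Cof M \<inter> Weq M \<longleftrightarrow> monic_with_cokernel_in C (\<CC> \<inter> \<WW>) f"
    and monic_Weq_iff: "admissible_monic C f \<Longrightarrow> f \<in> Weq M \<longleftrightarrow> monic_with_cokernel_in C \<WW> f"

definition monoid_axiom ::
  "'u rel \<Rightarrow> ('o, 'm, 'x) monoidal_exact_cat_scheme \<Rightarrow> 'm model_str \<Rightarrow> bool" where
  "monoid_axiom \<kappa> C M \<longleftrightarrow>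
     (\<forall>h. transfinite_composition \<kappa> C
            {f'. \<exists>f Y g g'. f \<in> Cof M \<inter> Weq M \<and> Y \<in> Obj C \<and> is_pushout C (f \<star>\<^bsub>C\<^esub> Id C Y) g f' g'} h
          \<longrightarrow> h \<in> Weq M)"

end

theory Submission
  imports Defs
begin

text \<open>
  Let \<open>f\<close> be an acyclic cofibration with cokernel \<open>X\<close>. By purity \<open>f \<star> Y\<close> is again a pure
  monic, with cokernel \<open>X \<odot> Y\<close>. In an exact category a pushout of an admissible monic is an
  admissible monic with the same cokernel; and since the monoidal structure is closed, tensoring
  preserves pushouts and zero morphisms, so pushouts of pure monics are pure. Hence every pushout
  of \<open>f \<star> Y\<close> is a pure monic with cokernel \<open>X \<odot> Y\<close>, which is acyclic by (1), and (2) applies to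
  the transfinite compositions of such pushouts.
\<close>

section \<open>Transfinite compositions and unfolded definitions\<close>

lemma transfinite_composition_mono:
  fixes \<kappa> :: "'u rel"
  assumes "transfinite_composition \<kappa> C I f" and "I \<subseteq> I'"
  shows "transfinite_composition \<kappa> C I' f"
proof -
  obtain r :: "'u rel" and F\<^sub>o F\<^sub>a L \<iota> z where
    "Well_order r \<and> |Field r| <o \<kappa> \<and> z \<in> Field r \<and> underS r z = {} \<and>
     transfinite_sequence C r F\<^sub>o F\<^sub>a \<and>
     (\<forall>a b. immediate_succ r a b \<longrightarrow> F\<^sub>a (a, b) \<in> I) \<and>
     is_colimit (order_cat r (Field r)) C F\<^sub>o F\<^sub>a L \<iota> \<and> f = \<iota> z"
    using assms(1) unfolding transfinite_composition_def by blast
  then show ?thesis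
    using assms(2) unfolding transfinite_composition_def
    by (intro exI[of _ r] exI[of _ F\<^sub>o] exI[of _ F\<^sub>a] exI[of _ L] exI[of _ \<iota>] exI[of _ z]) blast
qed

lemma HomD:
  assumes "f \<in> Hom C X Y"
  shows "f \<in> Arr C" and "Dom C f = X" and "Cod C f = Y"
  using assms by (auto simp: Hom_def)

lemma is_pushoutD:
  assumes "is_pushout C f g f' g'"
  shows "f \<in> Hom C (Dom C f) (Cod C f)" and "g \<in> Hom C (Dom C f) (Cod C g)"
    and "f' \<in> Hom C (Cod C g) (Cod C f')" and "g' \<in> Hom C (Cod C f) (Cod C f')"
    and "f' \<cdot>\<^bsub>C\<^esub> g = g' \<cdot>\<^bsub>C\<^esub> f"
  using assms by (auto simp: is_pushout_def Hom_def)

lemma is_pushout_ex1: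
  assumes "is_pushout C f g f' g'" and "u \<in> Hom C (Cod C g) T" and "v \<in> Hom C (Cod C f) T"
    and "u \<cdot>\<^bsub>C\<^esub> g = v \<cdot>\<^bsub>C\<^esub> f"
  shows "\<exists>!h. h \<in> Hom C (Cod C f') T \<and> h \<cdot>\<^bsub>C\<^esub> f' = u \<and> h \<cdot>\<^bsub>C\<^esub> g' = v"
  using assms unfolding is_pushout_def by blast

lemma is_cokernelD:
  assumes "is_cokernel C i p"
  shows "i \<in> Hom C (Dom C i) (Cod C i)" and "p \<in> Hom C (Cod C i) (Cod C p)"
    and "p \<cdot>\<^bsub>C\<^esub> i = Zero C (Dom C i) (Cod C p)"
  using assms by (auto simp: is_cokernel_def Hom_def)

lemma is_cokernel_ex1:
  assumes "is_cokernel C i p" and "t \<in> Hom C (Cod C i) T" and "t \<cdot>\<^bsub>C\<^esub> i = Zero C (Dom C i) T"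
  shows "\<exists>!s. s \<in> Hom C (Cod C p) T \<and> s \<cdot>\<^bsub>C\<^esub> p = t"
  using assms unfolding is_cokernel_def by blast

section \<open>Isomorphisms and uniqueness of pushouts\<close>

context category
begin

lemma Hom_Obj:
  assumes "f \<in> Hom C X Y"
  shows "X \<in> Obj C" and "Y \<in> Obj C"
  using assms Dom_in Cod_in by (auto simp: Hom_def)

lemma iso_arrI:
  assumes "f \<in> Hom C X Y" and "g \<in> Hom C Y X" and "g \<cdot> f = Id C X" and "f \<cdot> g = Id C Y"
  shows "iso_arr C f"
  using assms by (auto simp: iso_arr_def Hom_def)

lemma iso_arrE:
  assumes "iso_arr C f" and "f \<in> Hom C X Y"
  obtains g where "g \<in> Hom C Y X" and "g \<cdot> f = Id C X" and "f \<cdot> g = Id C Y"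
  using assms by (auto simp: iso_arr_def Hom_def)

lemma iso_arr_Id: "X \<in> Obj C \<Longrightarrow> iso_arr C (Id C X)"
  by (meson iso_arrI Id_in Id_left)

text \<open>The axiom \<open>monic_pushout\<close> provides only some pushout; this comparison
  carries its properties over to a given one. Both composites of the induced maps agree with the
  identity on the two legs, hence are identities.\<close>

lemma is_pushout_unique:
  assumes "is_pushout C f g f' g'" and "is_pushout C f g f'' g''"
  obtains h where "h \<in> Hom C (Cod C f') (Cod C f'')" and "iso_arr C h"
    and "h \<cdot> f' = f''" and "h \<cdot> g' = g''"
proof -
  note P' = is_pushoutD[OF assms(1)] and P'' = is_pushoutD[OF assms(2)]
  obtain h where h: "h \<in> Hom C (Cod C f') (Cod C f'')" "h \<cdot> f' = f''" "h \<cdot> g' = g''"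
    using is_pushout_ex1[OF assms(1) P''(3,4,5)] by blast
  obtain k where k: "k \<in> Hom C (Cod C f'') (Cod C f')" "k \<cdot> f'' = f'" "k \<cdot> g'' = g'"
    using is_pushout_ex1[OF assms(2) P'(3,4,5)] by blast
  have kh: "k \<cdot> h \<in> Hom C (Cod C f') (Cod C f')" "(k \<cdot> h) \<cdot> f' = f'" "(k \<cdot> h) \<cdot> g' = g'"
    using Comp_in[OF h(1) k(1)] Comp_assoc[OF P'(3) h(1) k(1)] Comp_assoc[OF P'(4) h(1) k(1)] h k
    by simp_all
  have hk: "h \<cdot> k \<in> Hom C (Cod C f'') (Cod C f'')" "(h \<cdot> k) \<cdot> f'' = f''" "(h \<cdot> k) \<cdot> g'' = g''"
    using Comp_in[OF k(1) h(1)] Comp_assoc[OF P''(3) k(1) h(1)] Comp_assoc[OF P''(4) k(1) h(1)] h k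
    by simp_all
  have "k \<cdot> h = Id C (Cod C f')"
    using is_pushout_ex1[OF assms(1) P'(3,4,5)] kh
      Id_in[OF Hom_Obj(2)[OF P'(3)]] Id_left[OF P'(3)] Id_left[OF P'(4)] by blast
  moreover have "h \<cdot> k = Id C (Cod C f'')"
    using is_pushout_ex1[OF assms(2) P''(3,4,5)] hk
      Id_in[OF Hom_Obj(2)[OF P''(3)]] Id_left[OF P''(3)] Id_left[OF P''(4)] by blast
  ultimately show ?thesis
    using that h k(1) iso_arrI by blast
qed

end

section \<open>Zero morphisms and uniqueness of cokernels\<close>

context additive_category
begin

lemma Zero_in: "\<lbrakk>X \<in> Obj C; Y \<in> Obj C\<rbrakk> \<Longrightarrow> Zero C X Y \<in> Hom C X Y"
  using monoid.one_closed[OF group.is_monoid[OF comm_group.axioms(2)[OF hom_group]]] by simp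

text \<open>A group has a single idempotent. Distributivity makes a composite with a zero morphism
  idempotent under addition, which is how \<open>Zero_Comp\<close> and \<open>Comp_Zero\<close>
  follow.\<close>

lemma Plus_idem_Zero:
  assumes "f \<in> Hom C X Y" and "f \<^bold>+ f = f"
  shows "f = Zero C X Y"
proof -
  interpret G: comm_group "\<lparr>carrier = Hom C X Y, mult = Plus C, one = Zero C X Y\<rparr>"
    using hom_group Hom_Obj[OF assms(1)] by blast
  show ?thesis
    using G.l_cancel_one[of f f] assms by simp
qed

lemma Zero_Plus_Zero: "\<lbrakk>X \<in> Obj C; Y \<in> Obj C\<rbrakk> \<Longrightarrow> Zero C X Y \<^bold>+ Zero C X Y = Zero C X Y"
  using monoid.l_one[OF group.is_monoid[OF comm_group.axioms(2)[OF hom_group]]] Zero_in by simp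

lemma Zero_Comp:
  assumes "f \<in> Hom C X Y" and "Z \<in> Obj C"
  shows "Zero C Y Z \<cdot> f = Zero C X Z"
proof (rule Plus_idem_Zero)
  have Y: "Y \<in> Obj C" using Hom_Obj assms by blast
  note 0 = Zero_in[OF Y assms(2)]
  show "Zero C Y Z \<cdot> f \<in> Hom C X Z" using Comp_in assms(1) 0 by blast
  show "(Zero C Y Z \<cdot> f) \<^bold>+ (Zero C Y Z \<cdot> f) = Zero C Y Z \<cdot> f"
    using Plus_Comp[OF assms(1) 0 0] Zero_Plus_Zero[OF Y assms(2)] by simp
qed

lemma Comp_Zero:
  assumes "f \<in> Hom C Y Z" and "X \<in> Obj C"
  shows "f \<cdot> Zero C X Y = Zero C X Z"
proof (rule Plus_idem_Zero)
  have Y: "Y \<in> Obj C" using Hom_Obj assms by blast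
  note 0 = Zero_in[OF assms(2) Y]
  show "f \<cdot> Zero C X Y \<in> Hom C X Z" using Comp_in assms(1) 0 by blast
  show "(f \<cdot> Zero C X Y) \<^bold>+ (f \<cdot> Zero C X Y) = f \<cdot> Zero C X Y"
    using Comp_Plus[OF 0 0 assms(1)] Zero_Plus_Zero[OF assms(2) Y] by simp
qed

lemma is_cokernel_unique:
  assumes "is_cokernel C i p" and "is_cokernel C i q"
  obtains h where "h \<in> Hom C (Cod C p) (Cod C q)" and "iso_arr C h" and "h \<cdot> p = q"
proof -
  note P = is_cokernelD[OF assms(1)] and Q = is_cokernelD[OF assms(2)]
  obtain h where h: "h \<in> Hom C (Cod C p) (Cod C q)" "h \<cdot> p = q"
    using is_cokernel_ex1[OF assms(1) Q(2,3)] by blast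
  obtain k where k: "k \<in> Hom C (Cod C q) (Cod C p)" "k \<cdot> q = p"
    using is_cokernel_ex1[OF assms(2) P(2,3)] by blast
  have "k \<cdot> h = Id C (Cod C p)"
    using is_cokernel_ex1[OF assms(1) P(2,3)] Comp_in[OF h(1) k(1)] Comp_assoc[OF P(2) h(1) k(1)]
      h(2) k(2) Id_in[OF Hom_Obj(2)[OF P(2)]] Id_left[OF P(2)] by metis
  moreover have "h \<cdot> k = Id C (Cod C q)"
    using is_cokernel_ex1[OF assms(2) Q(2,3)] Comp_in[OF k(1) h(1)] Comp_assoc[OF Q(2) k(1) h(1)]
      h(2) k(2) Id_in[OF Hom_Obj(2)[OF Q(2)]] Id_left[OF Q(2)] by metis
  ultimately show ?thesis
    using that h k(1) iso_arrI by blast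
qed

end

section \<open>Pushouts of admissible monics\<close>

context exact_category
begin

text \<open>\<open>Conf\<close> is closed under isomorphism: take identities on the first two terms
  and the comparison of the two cokernels on the third.\<close>

lemma Conf_is_cokernel:
  assumes "(i, p) \<in> Conf C" and "is_cokernel C i q"
  shows "(i, q) \<in> Conf C"
proof -
  have P: "is_cokernel C i p" using assms(1) Conf_kernel_cokernel by blast
  obtain h where h: "h \<in> Hom C (Cod C p) (Cod C q)" "iso_arr C h" "h \<cdot> p = q"
    using is_cokernel_unique[OF P assms(2)] by blast
  note i = is_cokernelD(1)[OF P] and q = is_cokernelD(2)[OF assms(2)]
  have ob: "Dom C i \<in> Obj C" "Cod C i \<in> Obj C" using Hom_Obj[OF i] by auto
  note I = HomD[OF Id_in[OF ob(1)]] HomD[OF Id_in[OF ob(2)]]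
  show ?thesis
    by (rule Conf_iso[OF assms(1) iso_arr_Id[OF ob(1)] iso_arr_Id[OF ob(2)] h(2)])
      (use I i q h Id_left[OF i] Id_right[OF i] Id_right[OF q] HomD[OF h(1)] in simp_all)
qed

lemma admissible_monic_pushout:
  assumes "admissible_monic C i" and "is_pushout C i g i' g'"
  shows "admissible_monic C i'"
proof -
  note P = is_pushoutD[OF assms(2)]
  obtain j k where jk: "is_pushout C i g j k" "admissible_monic C j"
    using monic_pushout[OF assms(1) HomD(1)[OF P(2)] HomD(2)[OF P(2)]] by blast
  obtain h where h: "h \<in> Hom C (Cod C j) (Cod C i')" "iso_arr C h" "h \<cdot> j = i'"
    using is_pushout_unique[OF jk(1) assms(2)] by blast
  obtain h' where h': "h' \<in> Hom C (Cod C i') (Cod C j)" "h' \<cdot> h = Id C (Cod C j)"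
    using iso_arrE[OF h(2,1)] by blast
  obtain q where q: "(j, q) \<in> Conf C" using jk(2) admissible_monic_def by metis
  have qH: "q \<in> Hom C (Cod C j) (Cod C q)"
    using is_cokernelD(2)[OF conjunct2[OF Conf_kernel_cokernel[OF q]]] .
  note j = is_pushoutD(3)[OF jk(1)]
  have ob: "Cod C g \<in> Obj C" "Cod C q \<in> Obj C" using Hom_Obj[OF j] Hom_Obj[OF qH] by auto
  note I = HomD[OF Id_in[OF ob(1)]] HomD[OF Id_in[OF ob(2)]]
  \<comment> \<open>The comparison \<open>h\<close> of the two pushouts, with identities on the
    outer terms, moves the conflation \<open>(j, q)\<close> to one that starts with
    \<open>i'\<close>.\<close>
  have "(i', q \<cdot> h') \<in> Conf C"
  proof (rule Conf_iso[OF q iso_arr_Id[OF ob(1)] h(2) iso_arr_Id[OF ob(2)]])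
    show "(q \<cdot> h') \<cdot> h = Id C (Cod C q) \<cdot> q"
      using Comp_assoc[OF h(1) h'(1) qH] h'(2) Id_right[OF qH] Id_left[OF qH] by simp
  qed (use I h P(3) Id_right[OF P(3)] HomD[OF h(1)] HomD[OF j] Comp_in[OF h'(1) qH] in simp_all)
  then show ?thesis using admissible_monic_def by metis
qed

text \<open>The conditions on \<open>q\<close> say that it is the map out of the pushout induced by
  zero and \<open>p\<close>. Maps out of the pushout that kill \<open>i'\<close> correspond, by
  restriction along \<open>g'\<close>, to maps that kill \<open>i\<close>, so \<open>q\<close>
  inherits the universal property of \<open>p\<close>.\<close>

lemma Conf_pushout:
  assumes "(i, p) \<in> Conf C" and "is_pushout C i g i' g'"
    and q: "q \<in> Hom C (Cod C i') (Cod C p)" "q \<cdot> i' = Zero C (Cod C g) (Cod C p)" "q \<cdot> g' = p"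
  shows "(i', q) \<in> Conf C"
proof -
  note P = is_pushoutD[OF assms(2)]
  have cok: "is_cokernel C i p" using assms(1) Conf_kernel_cokernel by blast
  have "\<exists>!s. s \<in> Hom C (Cod C q) T \<and> s \<cdot> q = t"
    if t: "t \<in> Hom C (Cod C i') T" "t \<cdot> i' = Zero C (Dom C i') T" for T t
  proof -
    have T: "T \<in> Obj C" using Hom_Obj t(1) by blast
    have tg: "t \<cdot> g' \<in> Hom C (Cod C i) T" using Comp_in[OF P(4) t(1)] .
    have t0: "t \<cdot> i' = Zero C (Cod C g) T" using t(2) HomD(2)[OF P(3)] by simp
    \<comment> \<open>Commutativity of the square turns the vanishing of \<open>t \<cdot> i'\<close>
      into that of \<open>t \<cdot> g'\<close> on \<open>i\<close>, so \<open>t \<cdot> g'\<close>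
      factors through \<open>p\<close>.\<close>
    have "(t \<cdot> g') \<cdot> i = (t \<cdot> i') \<cdot> g"
      using Comp_assoc[OF P(1,4) t(1)] Comp_assoc[OF P(2,3) t(1)] P(5) by simp
    then have tgi: "(t \<cdot> g') \<cdot> i = Zero C (Dom C i) T" "(t \<cdot> i') \<cdot> g = (t \<cdot> g') \<cdot> i"
      using t0 Zero_Comp[OF P(2) T] by simp_all
    note ex = is_cokernel_ex1[OF cok tg tgi(1)]
    obtain s where s: "s \<in> Hom C (Cod C p) T" "s \<cdot> p = t \<cdot> g'" using ex by blast
    \<comment> \<open>A map out of the pushout is determined by its two legs: here both sides vanish
      on \<open>i'\<close>, and both restrict to \<open>t \<cdot> g'\<close> along
      \<open>g'\<close>.\<close>
    have "(s \<cdot> q) \<cdot> i' = t \<cdot> i'"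
      using Comp_assoc[OF P(3) q(1) s(1)] q(2) Comp_Zero[OF s(1) Hom_Obj(2)[OF P(2)]] t0 by simp
    moreover have "(s \<cdot> q) \<cdot> g' = t \<cdot> g'"
      using Comp_assoc[OF P(4) q(1) s(1)] q(3) s(2) by simp
    ultimately have "s \<cdot> q = t"
      using is_pushout_ex1[OF assms(2) Comp_in[OF P(3) t(1)] tg tgi(2)] t(1)
        Comp_in[OF q(1) s(1)] by blast
    moreover have "s' = s" if "s' \<in> Hom C (Cod C p) T" "s' \<cdot> q = t" for s'
      using Comp_assoc[OF P(4) q(1) that(1)] that q(3) ex s by metis
    ultimately show ?thesis using s(1) HomD(3)[OF q(1)] by metis
  qed
  then have "is_cokernel C i' q"
    using P(3) q(1,2) unfolding is_cokernel_def Hom_def by auto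
  \<comment> \<open>Being a cokernel does not by itself give a conflation. Since \<open>i'\<close>
    is an admissible monic, it has some conflation \<open>(i', r)\<close>, in which \<open>r\<close>
    may be replaced by the cokernel \<open>q\<close>.\<close>
  moreover obtain r where "(i', r) \<in> Conf C"
    using admissible_monic_pushout assms(1,2) unfolding admissible_monic_def by blast
  ultimately show ?thesis using Conf_is_cokernel by blast
qed

end

section \<open>Tensoring with a fixed object\<close>

context closed_symmetric_monoidal
begin

lemma TensA_Id_in: "\<lbrakk>f \<in> Hom C X Y; Z \<in> Obj C\<rbrakk> \<Longrightarrow> f \<star> Id C Z \<in> Hom C (X \<odot> Z) (Y \<odot> Z)"
  using TensA_in Id_in by blast

lemma TensA_Id_Comp:
  assumes "f \<in> Hom C W X" and "g \<in> Hom C X Y" and "Z \<in> Obj C"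
  shows "(g \<star> Id C Z) \<cdot> (f \<star> Id C Z) = (g \<cdot> f) \<star> Id C Z"
  using TensA_Comp[OF assms(1,2) Id_in[OF assms(3)] Id_in[OF assms(3)]]
    Id_left[OF Id_in[OF assms(3)]] by simp

lemma TensA_Id_iso:
  assumes "iso_arr C f" and "f \<in> Hom C X Y" and "Z \<in> Obj C"
  shows "iso_arr C (f \<star> Id C Z)"
proof -
  obtain g where g: "g \<in> Hom C Y X" "g \<cdot> f = Id C X" "f \<cdot> g = Id C Y"
    using iso_arrE[OF assms(1,2)] by blast
  show ?thesis
    using iso_arrI[OF TensA_Id_in[OF assms(2,3)] TensA_Id_in[OF g(1) assms(3)]]
      TensA_Id_Comp[OF assms(2) g(1) assms(3)] TensA_Id_Comp[OF g(1) assms(2,3)] g(2,3)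
      TensA_Id[OF _ assms(3)] Hom_Obj[OF assms(2)] by simp
qed

text \<open>Tensoring with \<open>Z\<close> is a left adjoint. A compatible pair out of the tensored
  span is transposed to a pair into the internal hom, glued there by the original pushout, and
  transposed back.\<close>

lemma is_pushout_TensA:
  assumes po: "is_pushout C f g f' g'" and Z: "Z \<in> Obj C"
  shows "is_pushout C (f \<star> Id C Z) (g \<star> Id C Z) (f' \<star> Id C Z) (g' \<star> Id C Z)"
proof -
  note P = is_pushoutD[OF po]
  note t = TensA_Id_in[OF P(1) Z] TensA_Id_in[OF P(2) Z] TensA_Id_in[OF P(3) Z]
    TensA_Id_in[OF P(4) Z]
  have "\<exists>!h. h \<in> Hom C (Cod C f' \<odot> Z) T \<and> h \<cdot> (f' \<star> Id C Z) = u \<and> h \<cdot> (g' \<star> Id C Z) = v"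
    if u: "u \<in> Hom C (Cod C g \<odot> Z) T" and v: "v \<in> Hom C (Cod C f \<odot> Z) T"
      and uv: "u \<cdot> (g \<star> Id C Z) = v \<cdot> (f \<star> Id C Z)" for T u v
  proof -
    \<comment> \<open>\<open>H\<close> is the internal hom from \<open>Z\<close> to
      \<open>T\<close>, and \<open>ev\<close> is its evaluation map.\<close>
    obtain H ev where H: "H \<in> Obj C" and ev: "ev \<in> Hom C (H \<odot> Z) T"
      and adj: "\<And>X a. \<lbrakk>X \<in> Obj C; a \<in> Hom C (X \<odot> Z) T\<rbrakk>
        \<Longrightarrow> \<exists>!b. b \<in> Hom C X H \<and> ev \<cdot> (b \<star> Id C Z) = a"
      using closed[OF Z Hom_Obj(2)[OF u]] by blast
    \<comment> \<open>Transposition is natural in its source. Together with its injectivity, the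
      next fact \<open>cancel\<close>, this lets equations be checked after applying
      \<open>ev\<close>.\<close>
    have ev_Comp: "ev \<cdot> ((b \<cdot> a) \<star> Id C Z) = (ev \<cdot> (b \<star> Id C Z)) \<cdot> (a \<star> Id C Z)"
      if "a \<in> Hom C X Y" "b \<in> Hom C Y H" for a b X Y
      using TensA_Id_Comp[OF that Z]
        Comp_assoc[OF TensA_Id_in[OF that(1) Z] TensA_Id_in[OF that(2) Z] ev] by simp
    have cancel: "b = b'" if "b \<in> Hom C X H" "b' \<in> Hom C X H"
        "ev \<cdot> (b \<star> Id C Z) = ev \<cdot> (b' \<star> Id C Z)" for b b' X
      using adj[OF Hom_Obj(1)[OF that(1)] Comp_in[OF TensA_Id_in[OF that(2) Z] ev]] that by blast
    obtain a where a: "a \<in> Hom C (Cod C g) H" "ev \<cdot> (a \<star> Id C Z) = u"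
      using adj[OF Hom_Obj(2)[OF P(2)] u] by blast
    obtain b where b: "b \<in> Hom C (Cod C f) H" "ev \<cdot> (b \<star> Id C Z) = v"
      using adj[OF Hom_Obj(2)[OF P(1)] v] by blast
    have "a \<cdot> g = b \<cdot> f"
      using cancel[OF Comp_in[OF P(2) a(1)] Comp_in[OF P(1) b(1)]]
        ev_Comp[OF P(2) a(1)] ev_Comp[OF P(1) b(1)] a(2) b(2) uv by simp
    note ex = is_pushout_ex1[OF po a(1) b(1) this]
    then obtain k where k: "k \<in> Hom C (Cod C f') H" "k \<cdot> f' = a" "k \<cdot> g' = b" by blast
    show ?thesis
    proof (intro ex1I conjI)
      show "ev \<cdot> (k \<star> Id C Z) \<in> Hom C (Cod C f' \<odot> Z) T"
        using Comp_in[OF TensA_Id_in[OF k(1) Z] ev] .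
      show "(ev \<cdot> (k \<star> Id C Z)) \<cdot> (f' \<star> Id C Z) = u" using ev_Comp[OF P(3) k(1)] k a by simp
      show "(ev \<cdot> (k \<star> Id C Z)) \<cdot> (g' \<star> Id C Z) = v" using ev_Comp[OF P(4) k(1)] k b by simp
    next
      fix h assume h: "h \<in> Hom C (Cod C f' \<odot> Z) T \<and> h \<cdot> (f' \<star> Id C Z) = u \<and> h \<cdot> (g' \<star> Id C Z) = v"
      then obtain l where l: "l \<in> Hom C (Cod C f') H" "ev \<cdot> (l \<star> Id C Z) = h"
        using adj[OF Hom_Obj(2)[OF P(3)]] by blast
      have "l \<cdot> f' = a"
        using cancel[OF Comp_in[OF P(3) l(1)] a(1)] ev_Comp[OF P(3) l(1)] l(2) h a(2) by simp
      moreover have "l \<cdot> g' = b"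
        using cancel[OF Comp_in[OF P(4) l(1)] b(1)] ev_Comp[OF P(4) l(1)] l(2) h b(2) by simp
      ultimately show "h = ev \<cdot> (k \<star> Id C Z)" using ex k l by blast
    qed
  qed
  moreover have "(f' \<star> Id C Z) \<cdot> (g \<star> Id C Z) = (g' \<star> Id C Z) \<cdot> (f \<star> Id C Z)"
    using TensA_Id_Comp[OF P(2,3) Z] TensA_Id_Comp[OF P(1,4) Z] P(5) by simp
  ultimately show ?thesis
    using HomD[OF t(1)] HomD[OF t(2)] HomD[OF t(3)] HomD[OF t(4)]
    unfolding is_pushout_def by simp
qed

end

section \<open>Pure exact sequences\<close>

context closed_symmetric_monoidal_exact_category
begin

text \<open>Additivity of the tensor product is not an axiom of the locale, so the zero morphism is
  factored through a zero object \<open>N\<close>. This is needed to see that a tensored cokernel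
  map still kills the tensored monic.\<close>

lemma Zero_TensA:
  assumes X: "X \<in> Obj C" and Y: "Y \<in> Obj C" and Z: "Z \<in> Obj C"
  shows "Zero C X Y \<star> Id C Z = Zero C (X \<odot> Z) (Y \<odot> Z)"
proof -
  obtain N where N: "N \<in> Obj C"
    and zero: "\<forall>X \<in> Obj C. (\<exists>!f. f \<in> Hom C X N) \<and> (\<exists>!f. f \<in> Hom C N X)"
    using zero_object by (rule bexE)
  have init: "f = g" if "f \<in> Hom C N H" "g \<in> Hom C N H" for f g H
    using conjunct2[OF bspec[OF zero Hom_Obj(2)[OF that(1)]]] that by blast
  have YZ: "Y \<odot> Z \<in> Obj C" and NZ: "N \<odot> Z \<in> Obj C" using TensO_in Y Z N by auto
  obtain H ev where adj: "\<forall>X \<in> Obj C. \<forall>f \<in> Hom C (X \<odot> Z) (Y \<odot> Z).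
      \<exists>!g. g \<in> Hom C X H \<and> ev \<cdot> (g \<star> Id C Z) = f"
    using closed[OF Z YZ] by (elim bexE)
  note x = Zero_in[OF X N] and y = Zero_in[OF N Y]
  \<comment> \<open>The tensor product with \<open>Z\<close> is a left adjoint, so \<open>N \<odot> Z\<close> is again initial.\<close>
  obtain g where g: "g \<in> Hom C N H" "ev \<cdot> (g \<star> Id C Z) = Zero C N Y \<star> Id C Z"
    using adj[rule_format, OF N TensA_Id_in[OF y Z]] by blast
  obtain g' where g': "g' \<in> Hom C N H" "ev \<cdot> (g' \<star> Id C Z) = Zero C (N \<odot> Z) (Y \<odot> Z)"
    using adj[rule_format, OF N Zero_in[OF NZ YZ]] by blast
  have "Zero C N Y \<star> Id C Z = Zero C (N \<odot> Z) (Y \<odot> Z)"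
    using g g' init[OF g(1) g'(1)] by simp
  then have "(Zero C N Y \<cdot> Zero C X N) \<star> Id C Z = Zero C (X \<odot> Z) (Y \<odot> Z)"
    using TensA_Id_Comp[OF x y Z] Zero_Comp[OF TensA_Id_in[OF x Z] YZ] by simp
  then show ?thesis using Zero_Comp[OF x Y] by simp
qed

lemma pure_exactD:
  assumes "pure_exact C i p"
  shows "i \<in> Hom C (Dom C i) (Cod C i)" and "p \<in> Hom C (Cod C i) (Cod C p)"
    and "(i, p) \<in> Conf C" and "Z \<in> Obj C \<Longrightarrow> (i \<star> Id C Z, p \<star> Id C Z) \<in> Conf C"
proof -
  show *: "(i, p) \<in> Conf C" and "Z \<in> Obj C \<Longrightarrow> (i \<star> Id C Z, p \<star> Id C Z) \<in> Conf C"
    using assms by (simp_all add: pure_exact_def)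
  show "i \<in> Hom C (Dom C i) (Cod C i)" "p \<in> Hom C (Cod C i) (Cod C p)"
    using is_cokernelD(1,2)[OF conjunct2[OF Conf_kernel_cokernel[OF *]]] .
qed

text \<open>Purity does not depend on the chosen cokernel: the comparison isomorphism of two
  cokernels stays an isomorphism after tensoring with any \<open>Z\<close>.\<close>

lemma pure_exact_Conf:
  assumes "pure_exact C i p" and "(i, q) \<in> Conf C"
  shows "pure_exact C i q"
proof -
  note P = pure_exactD[OF assms(1)]
  have cp: "is_cokernel C i p" and cq: "is_cokernel C i q"
    using Conf_kernel_cokernel assms(2) P(3) by blast+
  obtain h where h: "h \<in> Hom C (Cod C p) (Cod C q)" "iso_arr C h" "h \<cdot> p = q"
    using is_cokernel_unique[OF cp cq] by blast
  have "(i \<star> Id C Z, q \<star> Id C Z) \<in> Conf C" if Z: "Z \<in> Obj C" for Z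
  proof -
    note ti = TensA_Id_in[OF P(1) Z] and tp = TensA_Id_in[OF P(2) Z]
      and tq = TensA_Id_in[OF is_cokernelD(2)[OF cq] Z] and th = TensA_Id_in[OF h(1) Z]
    note ob = Hom_Obj[OF ti]
    show ?thesis
      by (rule Conf_iso[OF P(4)[OF Z] iso_arr_Id[OF ob(1)] iso_arr_Id[OF ob(2)]
            TensA_Id_iso[OF h(2,1) Z]])
        (use ti tp tq th HomD[OF ti] HomD[OF tp] HomD[OF th] HomD[OF Id_in[OF ob(1)]]
            HomD[OF Id_in[OF ob(2)]] Id_left[OF ti] Id_right[OF ti] Id_right[OF tq]
            TensA_Id_Comp[OF P(2) h(1) Z] h(3) in simp_all)
  qed
  then show ?thesis using assms(2) by (simp add: pure_exact_def)
qed

text \<open>By associativity, tensoring with \<open>Y\<close> and then with \<open>Z\<close> amounts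
  to tensoring once with \<open>Y \<odot> Z\<close>, for which exactness is part of the purity of
  \<open>(i, p)\<close>.\<close>

lemma pure_exact_TensA:
  assumes "pure_exact C i p" and Y: "Y \<in> Obj C"
  shows "pure_exact C (i \<star> Id C Y) (p \<star> Id C Y)"
proof -
  note P = pure_exactD[OF assms(1)]
  have "((i \<star> Id C Y) \<star> Id C Z, (p \<star> Id C Y) \<star> Id C Z) \<in> Conf C" if Z: "Z \<in> Obj C" for Z
  proof -
    have YZ: "Y \<odot> Z \<in> Obj C" using TensO_in Y Z by blast
    \<comment> \<open>\<open>J X\<close> is the inverse of the associator, chosen as a function of
      \<open>X\<close> because it is used at all three terms of the sequence.\<close>
    define J where "J X = (SOME j. j \<in> Hom C (X \<odot> (Y \<odot> Z)) ((X \<odot> Y) \<odot> Z) \<and>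
      j \<cdot> Assoc C X Y Z = Id C ((X \<odot> Y) \<odot> Z) \<and> Assoc C X Y Z \<cdot> j = Id C (X \<odot> (Y \<odot> Z)))" for X
    have A: "Assoc C X Y Z \<in> Hom C ((X \<odot> Y) \<odot> Z) (X \<odot> (Y \<odot> Z))" "iso_arr C (Assoc C X Y Z)"
      if "X \<in> Obj C" for X
      using Assoc_in[OF that Y Z] by auto
    have "J X \<in> Hom C (X \<odot> (Y \<odot> Z)) ((X \<odot> Y) \<odot> Z) \<and>
      J X \<cdot> Assoc C X Y Z = Id C ((X \<odot> Y) \<odot> Z) \<and> Assoc C X Y Z \<cdot> J X = Id C (X \<odot> (Y \<odot> Z))"
      if "X \<in> Obj C" for X
      unfolding J_def by (rule someI_ex) (rule iso_arrE[OF A(2,1)[OF that]], blast)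
    then have J: "J X \<in> Hom C (X \<odot> (Y \<odot> Z)) ((X \<odot> Y) \<odot> Z)"
      "J X \<cdot> Assoc C X Y Z = Id C ((X \<odot> Y) \<odot> Z)" "Assoc C X Y Z \<cdot> J X = Id C (X \<odot> (Y \<odot> Z))"
      if "X \<in> Obj C" for X
      using that by blast+
    have J_iso: "iso_arr C (J X)" if "X \<in> Obj C" for X
      using iso_arrI[OF J(1) A(1)] J(2,3) that by blast
    have nat: "((f \<star> Id C Y) \<star> Id C Z) \<cdot> J X = J X' \<cdot> (f \<star> Id C (Y \<odot> Z))"
      if f: "f \<in> Hom C X X'" for f X X'
    proof -
      note X = Hom_Obj[OF f]
      note tf = TensA_Id_in[OF TensA_Id_in[OF f Y] Z] and tf' = TensA_Id_in[OF f YZ]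
      have eq: "Assoc C X' Y Z \<cdot> ((f \<star> Id C Y) \<star> Id C Z) = (f \<star> Id C (Y \<odot> Z)) \<cdot> Assoc C X Y Z"
        using Assoc_nat[OF f Id_in[OF Y] Id_in[OF Z]] TensA_Id[OF Y Z] by simp
      \<comment> \<open>Naturality of the inverse: insert \<open>J X' \<cdot> Assoc C X' Y Z\<close>
        on the left, move \<open>f\<close> across by naturality of the associator, and cancel
        \<open>Assoc C X Y Z \<cdot> J X\<close>.\<close>
      have "((f \<star> Id C Y) \<star> Id C Z) \<cdot> J X
          = (J X' \<cdot> Assoc C X' Y Z) \<cdot> (((f \<star> Id C Y) \<star> Id C Z) \<cdot> J X)"
        using J(2)[OF X(2)] Id_left[OF Comp_in[OF J(1)[OF X(1)] tf]] by simp
      also have "\<dots> = J X' \<cdot> (Assoc C X' Y Z \<cdot> (((f \<star> Id C Y) \<star> Id C Z) \<cdot> J X))"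
        using Comp_assoc[OF Comp_in[OF J(1)[OF X(1)] tf] A(1)[OF X(2)] J(1)[OF X(2)]] .
      also have "\<dots> = J X' \<cdot> ((f \<star> Id C (Y \<odot> Z)) \<cdot> (Assoc C X Y Z \<cdot> J X))"
        using Comp_assoc[OF J(1)[OF X(1)] tf A(1)[OF X(2)]] eq
          Comp_assoc[OF J(1)[OF X(1)] A(1)[OF X(1)] tf'] by simp
      also have "\<dots> = J X' \<cdot> (f \<star> Id C (Y \<odot> Z))"
        using J(3)[OF X(1)] Id_right[OF tf'] by simp
      finally show ?thesis .
    qed
    note ob = Hom_Obj[OF P(1)] Hom_Obj(2)[OF P(2)]
    note ti = TensA_Id_in[OF P(1) YZ] and tp = TensA_Id_in[OF P(2) YZ]
    show ?thesis
      \<comment> \<open>The three maps \<open>J\<close> form an isomorphism from the sequence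
        tensored with \<open>Y \<odot> Z\<close>; \<open>nat\<close> supplies its commuting
        squares.\<close>
      by (rule Conf_iso[OF P(4)[OF YZ] J_iso[OF ob(1)] J_iso[OF ob(2)] J_iso[OF ob(3)]])
        (use HomD[OF J(1)[OF ob(1)]] HomD[OF J(1)[OF ob(2)]] HomD[OF J(1)[OF ob(3)]]
            HomD[OF ti] HomD[OF tp] nat[OF P(1)] nat[OF P(2)]
            TensA_Id_in[OF TensA_Id_in[OF P(1) Y] Z] TensA_Id_in[OF TensA_Id_in[OF P(2) Y] Z]
          in simp_all)
  qed
  then show ?thesis using P(4)[OF Y] by (simp add: pure_exact_def)
qed

text \<open>The tensored square is again a pushout, so \<open>Conf_pushout\<close> applies to it for
  every \<open>Z\<close>. The new cokernel map is induced by zero and \<open>p\<close>, so the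
  cokernel object is equal to the old one and not merely isomorphic.\<close>

lemma pure_exact_pushout:
  assumes "pure_exact C i p" and po: "is_pushout C i g i' g'"
  obtains q where "pure_exact C i' q" and "Cod C q = Cod C p"
proof -
  note P = pure_exactD[OF assms(1)] and Q = is_pushoutD[OF po]
  have D: "Cod C p \<in> Obj C" and A: "Cod C g \<in> Obj C"
    using Hom_Obj(2) P(2) Q(2) by blast+
  have "Zero C (Cod C g) (Cod C p) \<cdot> g = p \<cdot> i"
    using Zero_Comp[OF Q(2) D] is_cokernelD(3)[OF conjunct2[OF Conf_kernel_cokernel[OF P(3)]]] by simp
  then obtain q where q: "q \<in> Hom C (Cod C i') (Cod C p)"
      "q \<cdot> i' = Zero C (Cod C g) (Cod C p)" "q \<cdot> g' = p"
    using is_pushout_ex1[OF po Zero_in[OF A D] P(2)] by blast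
  have "(i' \<star> Id C Z, q \<star> Id C Z) \<in> Conf C" if Z: "Z \<in> Obj C" for Z
  proof (rule Conf_pushout[OF P(4)[OF Z] is_pushout_TensA[OF po Z]])
    note c = HomD[OF TensA_Id_in[OF P(2) Z]] HomD[OF TensA_Id_in[OF Q(2) Z]]
      HomD[OF TensA_Id_in[OF Q(3) Z]]
    show "q \<star> Id C Z \<in> Hom C (Cod C (i' \<star> Id C Z)) (Cod C (p \<star> Id C Z))"
      using c TensA_Id_in[OF q(1) Z] by simp
    show "(q \<star> Id C Z) \<cdot> (i' \<star> Id C Z) = Zero C (Cod C (g \<star> Id C Z)) (Cod C (p \<star> Id C Z))"
      using c TensA_Id_Comp[OF Q(3) q(1) Z] q(2) Zero_TensA[OF A D Z] by simp
    show "(q \<star> Id C Z) \<cdot> (g' \<star> Id C Z) = p \<star> Id C Z"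
      using TensA_Id_Comp[OF Q(4) q(1) Z] q(3) by simp
  qed
  then have "pure_exact C i' q"
    using Conf_pushout[OF P(3) po q] by (simp add: pure_exact_def)
  then show ?thesis using that HomD(3)[OF q(1)] by blast
qed

end

section \<open>The monoid axiom\<close>

theorem theorem17:
  fixes \<kappa> :: "'u rel"
    and E :: "('o, 'm, 'x) monoidal_exact_cat_scheme"
    and M :: "'m model_str"
    and \<CC> \<WW> :: "'o set"
  assumes "smallness_bound \<kappa>"
    and "closed_symmetric_monoidal_exact_category E"
    and "complete \<kappa> E"
    and "cocomplete \<kappa> E"
    and "left_pseudo_compatible E M \<CC> \<WW>"
    and a: "\<And>f. f \<in> Cof M \<Longrightarrow> pure_monic E f"
    and b: "\<And>X Y. \<lbrakk>X \<in> \<CC>; Y \<in> \<CC>\<rbrakk> \<Longrightarrow> X \<odot>\<^bsub>E\<^esub> Y \<in> \<CC>"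
    and c: "\<And>X Y. \<lbrakk>X \<in> \<CC>; Y \<in> \<CC>; X \<in> \<WW> \<or> Y \<in> \<WW>\<rbrakk> \<Longrightarrow> X \<odot>\<^bsub>E\<^esub> Y \<in> \<CC> \<inter> \<WW>"
    and d: "\<And>C p X. \<lbrakk>C \<in> \<CC>; p \<in> Hom E C (Unit E); p \<in> Fib M \<inter> Weq M; X \<in> Obj E\<rbrakk>
              \<Longrightarrow> LUnit E X \<cdot>\<^bsub>E\<^esub> (p \<star>\<^bsub>E\<^esub> Id E X) \<in> Weq M"
    and h1: "\<And>X Y. \<lbrakk>X \<in> \<CC> \<inter> \<WW>; Y \<in> Obj E\<rbrakk> \<Longrightarrow> X \<odot>\<^bsub>E\<^esub> Y \<in> \<WW>"
    and h2: "\<And>h. transfinite_composition \<kappa> E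
                {f \<in> Weq M. pure_monic E f \<and>
                   monic_with_cokernel_in E {X \<odot>\<^bsub>E\<^esub> Y |X Y. X \<in> \<CC> \<inter> \<WW> \<and> Y \<in> Obj E} f} h
              \<Longrightarrow> h \<in> Weq M"
  shows "monoid_axiom \<kappa> E M"
  unfolding monoid_axiom_def
proof (intro allI impI)
  interpret closed_symmetric_monoidal_exact_category E by fact
  interpret left_pseudo_compatible E M \<CC> \<WW> by fact
  let ?T = "{X \<odot>\<^bsub>E\<^esub> Y |X Y. X \<in> \<CC> \<inter> \<WW> \<and> Y \<in> Obj E}"
  let ?P = "{f'. \<exists>f Y g g'. f \<in> Cof M \<inter> Weq M \<and> Y \<in> Obj E \<and>
    is_pushout E (f \<star>\<^bsub>E\<^esub> Id E Y) g f' g'}"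
  \<comment> \<open>Each generator of the monoid axiom lies in the class that \<open>h2\<close>
    controls; monotonicity of transfinite composition in the class then finishes the proof.\<close>
  have sub: "?P \<subseteq> {f \<in> Weq M. pure_monic E f \<and> monic_with_cokernel_in E ?T f}"
  proof
    fix f' assume "f' \<in> ?P"
    then obtain f Y g g' where f: "f \<in> Cof M \<inter> Weq M" and Y: "Y \<in> Obj E"
      and po: "is_pushout E (f \<star>\<^bsub>E\<^esub> Id E Y) g f' g'" by blast
    obtain p where p: "(f, p) \<in> Conf E" "Cod E p \<in> \<CC> \<inter> \<WW>"
      using f acyclic_Cof_iff unfolding monic_with_cokernel_in_def by blast
    \<comment> \<open>The cokernel map \<open>p\<close> has its target in
      \<open>\<CC> \<inter> \<WW>\<close>, while (a) gives purity with a possibly different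
      \<open>p'\<close>; purity is transferred to \<open>p\<close>.\<close>
    obtain p' where "pure_exact E f p'" using a[OF IntD1[OF f]] unfolding pure_monic_def by blast
    then have fp: "pure_exact E f p" using p(1) by (rule pure_exact_Conf)
    obtain q where q: "pure_exact E f' q" "Cod E q = Cod E (p \<star>\<^bsub>E\<^esub> Id E Y)"
      using pure_exact_pushout[OF pure_exact_TensA[OF fp Y] po] by blast
    \<comment> \<open>The cokernel has literally the product form that both \<open>h1\<close> and
      \<open>h2\<close> require.\<close>
    have cod: "Cod E q = Cod E p \<odot>\<^bsub>E\<^esub> Y"
      using q(2) HomD(3)[OF TensA_Id_in[OF pure_exactD(2)[OF fp] Y]] by simp
    note conf = pure_exactD(3)[OF q(1)]
    have adm: "admissible_monic E f'" using conf unfolding admissible_monic_def by blast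
    \<comment> \<open>By (1) the cokernel of \<open>f'\<close> is in \<open>\<WW>\<close>, and for
      an admissible monic this already means being a weak equivalence.\<close>
    have "monic_with_cokernel_in E \<WW> f'"
      using conf cod h1[OF p(2) Y] unfolding monic_with_cokernel_in_def by metis
    then have "f' \<in> Weq M" using monic_Weq_iff[OF adm] by blast
    moreover have "pure_monic E f'" using adm q(1) unfolding pure_monic_def by blast
    moreover have "Cod E q \<in> ?T" using cod p(2) Y by blast
    then have "monic_with_cokernel_in E ?T f'"
      using conf unfolding monic_with_cokernel_in_def by blast
    ultimately show "f' \<in> {f \<in> Weq M. pure_monic E f \<and> monic_with_cokernel_in E ?T f}" by blast
  qed
  fix h assume "transfinite_composition \<kappa> E ?P h"
  then show "h \<in> Weq M" by (rule h2[OF transfinite_composition_mono[OF _ sub]])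
qed

end
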